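(* Let $p>1$, $0<s<1$, let $\Omega\subset\mathbb{R}^N$ be a bounded domain with $C^{1,1}$ boundary, let $g\in W_0^{s,p}(\Omega)^*\cap L^1(\Omega)$, and let $u\in W_0^{s,p}(\Omega)$ be a weak solution of $$(-\Delta)_p^su=g(x)\ \text{in }\Omega,\qquad u=0\ \text{in }\mathbb{R}^N\setminus\Omega.$$ Let $\Psi\in C^2(\mathbb{R})$ be convex and Lipschitz with $\Psi(0)=0$. If in addition either $\Psi''\in L^\infty(\mathbb{R})$ or $g$ has a constant sign, then $$\langle(-\Delta)_p^s\Psi(u),\psi\rangle\le\int_\Omega|\Psi'(u)|^{p-2}\Psi'(u)\,g\,\psi\,dx\qquad\text{for all }\psi\in W_0^{s,p}(\Omega)\cap L^\infty(\Omega),\ \psi\ge0.$$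
   Context: Function space: $[u]_{s,p}=\left(\int_{\mathbb{R}^{2N}}\frac{|u(x)-u(y)|^p}{|x-y|^{N+sp}}\,dx\,dy\right)^{1/p}$, $W^{s,p}(\mathbb{R}^N)=\{u\in L^p(\mathbb{R}^N):[u]_{s,p}<\infty\}$, and $W_0^{s,p}(\Omega)=\{u\in W^{s,p}(\mathbb{R}^N): u=0 \text{ a.e. in }\mathbb{R}^N\setminus\Omega\}$ with norm $\|u\|_{W_0^{s,p}(\Omega)}=[u]_{s,p}$; $W_0^{s,p}(\Omega)^*$ is its dual. For a function $g$ on $\Omega$, $g\in W_0^{s,p}(\Omega)^*$ means that for every $v\in W_0^{s,p}(\Omega)$, $gv\in L^1(\Omega)$ and $|\int_\Omega gv\,dx|\le C\|v\|_{W_0^{s,p}(\Omega)}$ with $C$ independent of $v$. Operator: for $w,v\in W_0^{s,p}(\Omega)$, $\langle(-\Delta)_p^s w,v\rangle=\int_{\mathbb{R}^{2N}}\frac{J_w(x,y)(v(x)-v(y))}{|x-y|^{N+sp}}\,dx\,dy$ with $J_w(x,y)=|w(x)-w(y)|^{p-2}(w(x)-w(y))$. Expressions $|a|^{p-2}a$ are read as $0$ when $a=0$. Weak solution: $u\in W_0^{s,p}(\Omega)$ with $\langle(-\Delta)_p^su,v\rangle=\int_\Omega gv\,dx$ for all $v\in W_0^{s,p}(\Omega)$, $v\ge0$. "Constant sign" means $g\ge0$ a.e. or $g\le0$ a.e. in $\Omega$. *)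

theory Defs
  imports "HOL-Analysis.Analysis"
begin

text \<open>
  Functions are real-valued and defined on all of \<open>real ^ 'n\<close>, so that \<open>N = CARD('n)\<close>. For a
  function on \<open>\<Omega>\<close> only the restriction to \<open>\<Omega>\<close> matters. Measurability and null sets are those of the
  complete Lebesgue measure, also on the product space.
\<close>

definition C11_function :: "(real ^ 'n \<Rightarrow> real) \<Rightarrow> bool" where
  "C11_function \<gamma> \<longleftrightarrow>
     (\<exists>G L. (\<forall>x. (\<gamma> has_derivative (\<lambda>h. G x \<bullet> h)) (at x)) \<and>
            L-lipschitz_on UNIV (G :: real ^ 'n \<Rightarrow> real ^ 'n))"

text \<open>
  Near each boundary point, in some Cartesian coordinate system, \<open>\<Omega>\<close> is the strict epigraph of a
  \<open>C\<^sup>1\<^sup>,\<^sup>1\<close> function of the first \<open>N - 1\<close> coordinates. The unit vector \<open>e\<close> is the last coordinate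
  direction, \<open>x \<bullet> e\<close> the last coordinate, and \<open>x - (x \<bullet> e) *\<^sub>R e\<close> the projection onto the hyperplane
  orthogonal to \<open>e\<close>, which stands for the other \<open>N - 1\<close> coordinates. A \<open>C\<^sup>1\<^sup>,\<^sup>1\<close> function on that
  hyperplane is the same as the restriction of a \<open>C\<^sup>1\<^sup>,\<^sup>1\<close> function on the whole space (extend it
  constantly along \<open>e\<close>), so \<open>\<gamma>\<close> may be taken on the whole space. For \<open>N = 1\<close> the hyperplane is a
  single point.
\<close>

definition C11_boundary :: "(real ^ 'n) set \<Rightarrow> bool" where
  "C11_boundary \<Omega> \<longleftrightarrow>
     (\<forall>x0 \<in> frontier \<Omega>. \<exists>r > 0. \<exists>e \<gamma>. norm e = 1 \<and> C11_function \<gamma> \<and>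
        \<Omega> \<inter> ball x0 r = {x \<in> ball x0 r. \<gamma> (x - (x \<bullet> e) *\<^sub>R e) < x \<bullet> e})"

definition bounded_C11_domain :: "(real ^ 'n) set \<Rightarrow> bool" where
  "bounded_C11_domain \<Omega> \<longleftrightarrow>
     open \<Omega> \<and> connected \<Omega> \<and> \<Omega> \<noteq> {} \<and> bounded \<Omega> \<and> C11_boundary \<Omega>"

text \<open>
  The \<open>p\<close>-th power of the Gagliardo seminorm. On the diagonal, a null set, the integrand is \<open>0\<close> by
  the convention for division by zero.
\<close>

definition gagliardo_energy :: "real \<Rightarrow> real \<Rightarrow> (real ^ 'n \<Rightarrow> real) \<Rightarrow> ennreal" where
  "gagliardo_energy s p u =
     (\<integral>\<^sup>+ z. ennreal (\<bar>u (fst z) - u (snd z)\<bar> powr p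
              / norm (fst z - snd z) powr (real CARD('n) + s * p))
        \<partial>(lebesgue :: ((real ^ 'n) \<times> (real ^ 'n)) measure))"

text \<open>Meaningful only if the energy is finite, as it is for the elements of the spaces below.\<close>

definition gagliardo_seminorm :: "real \<Rightarrow> real \<Rightarrow> (real ^ 'n \<Rightarrow> real) \<Rightarrow> real" where
  "gagliardo_seminorm s p u = enn2real (gagliardo_energy s p u) powr (1 / p)"

definition Wsp :: "real \<Rightarrow> real \<Rightarrow> (real ^ 'n \<Rightarrow> real) set" where
  "Wsp s p = {u. u \<in> borel_measurable lebesgue \<and>
                 integrable lebesgue (\<lambda>x. \<bar>u x\<bar> powr p) \<and>
                 gagliardo_energy s p u < \<infinity>}"

definition Wsp0 :: "real \<Rightarrow> real \<Rightarrow> (real ^ 'n) set \<Rightarrow> (real ^ 'n \<Rightarrow> real) set" where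
  "Wsp0 s p \<Omega> = {u \<in> Wsp s p. AE x in lebesgue. x \<notin> \<Omega> \<longrightarrow> u x = 0}"

definition in_Wsp0_dual :: "real \<Rightarrow> real \<Rightarrow> (real ^ 'n) set \<Rightarrow> (real ^ 'n \<Rightarrow> real) \<Rightarrow> bool" where
  "in_Wsp0_dual s p \<Omega> g \<longleftrightarrow>
     (\<forall>v \<in> Wsp0 s p \<Omega>. integrable (lebesgue_on \<Omega>) (\<lambda>x. g x * v x)) \<and>
     (\<exists>C. \<forall>v \<in> Wsp0 s p \<Omega>.
        \<bar>\<integral>x. g x * v x \<partial>lebesgue_on \<Omega>\<bar> \<le> C * gagliardo_seminorm s p v)"

definition L_infinity :: "('a :: euclidean_space) set \<Rightarrow> ('a \<Rightarrow> real) set" where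
  "L_infinity A = {f \<in> borel_measurable (lebesgue_on A). \<exists>M. AE x in lebesgue_on A. \<bar>f x\<bar> \<le> M}"

text \<open>\<open>|a|\<^bsup>p-2\<^esup>a\<close>; it vanishes at \<open>a = 0\<close> for every \<open>p\<close>.\<close>

definition spow :: "real \<Rightarrow> real \<Rightarrow> real" where
  "spow p a = \<bar>a\<bar> powr (p - 2) * a"

definition frac_plap :: "real \<Rightarrow> real \<Rightarrow> (real ^ 'n \<Rightarrow> real) \<Rightarrow> (real ^ 'n \<Rightarrow> real) \<Rightarrow> real" where
  "frac_plap s p w v =
     (\<integral>z. spow p (w (fst z) - w (snd z)) * (v (fst z) - v (snd z))
            / norm (fst z - snd z) powr (real CARD('n) + s * p)
        \<partial>(lebesgue :: ((real ^ 'n) \<times> (real ^ 'n)) measure))"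

definition weak_solution ::
    "real \<Rightarrow> real \<Rightarrow> (real ^ 'n) set \<Rightarrow> (real ^ 'n \<Rightarrow> real) \<Rightarrow> (real ^ 'n \<Rightarrow> real) \<Rightarrow> bool" where
  "weak_solution s p \<Omega> g u \<longleftrightarrow>
     u \<in> Wsp0 s p \<Omega> \<and>
     (\<forall>v \<in> Wsp0 s p \<Omega>. (AE x in lebesgue. 0 \<le> v x) \<longrightarrow>
        frac_plap s p u v = (\<integral>x. g x * v x \<partial>lebesgue_on \<Omega>))"

definition constant_sign :: "(real ^ 'n) set \<Rightarrow> (real ^ 'n \<Rightarrow> real) \<Rightarrow> bool" where
  "constant_sign \<Omega> g \<longleftrightarrow>
     (AE x in lebesgue_on \<Omega>. 0 \<le> g x) \<or> (AE x in lebesgue_on \<Omega>. g x \<le> 0)"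

definition C2_real :: "(real \<Rightarrow> real) \<Rightarrow> bool" where
  "C2_real \<Psi> \<longleftrightarrow> \<Psi> differentiable_on UNIV \<and> deriv \<Psi> differentiable_on UNIV \<and>
                continuous_on UNIV (deriv (deriv \<Psi>))"

end

theory Submission
  imports Defs
begin

text \<open>
  The test function \<open>\<psi> |\<Psi>'(u)|\<^bsup>p-2\<^esup>\<Psi>'(u)\<close> need not have finite energy, so \<open>h = |\<Psi>'|\<^bsup>p-2\<^esup>\<Psi>' + C\<close>, which
  is continuous, nondecreasing and, for a suitable constant \<open>C\<close>, nonnegative and bounded, is
  approximated from below by its Lipschitz inf-convolutions \<open>h\<^sub>n\<close>. These are again nondecreasing, so
  the part of the energy integrand for the test function \<open>\<psi> h\<^sub>n(u)\<close> that contains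
  \<open>h\<^sub>n(u(x)) - h\<^sub>n(u(y))\<close> is nonnegative, and the rest is dominated uniformly in \<open>n\<close>. Fatou's lemma
  on the left and dominated convergence on the right (\<open>g\<close> is integrable and \<open>\<psi>\<close> bounded) let
  \<open>n\<close> tend to infinity. The limit of the integrand is bounded below pointwise by convexity of \<open>\<Psi>\<close>, and
  the contribution of \<open>C\<close> cancels by the weak equation for \<open>\<psi>\<close>.
\<close>

section \<open>The signed power: monotonicity, growth and the convexity inequality\<close>

text \<open>For \<open>p < 2\<close> the factor \<open>\<bar>a\<bar> powr (p - 2)\<close> blows up
  at 0. The positive exponent \<open>p - 1\<close> makes monotonicity and continuity visible across
  0.\<close>

lemma spow_eq_powr:
  assumes "p > 1"
  shows "spow p a = max a 0 powr (p - 1) - max (- a) 0 powr (p - 1)"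
proof (cases a "0::real" rule: linorder_cases)
  case less
  then have "(- a) powr (p - 1) = (- a) powr (p - 2) * (- a)"
    using powr_add[of "- a" "p - 2" 1] by simp
  with less show ?thesis by (simp add: spow_def)
next
  case greater
  then have "a powr (p - 1) = a powr (p - 2) * a"
    using powr_add[of a "p - 2" 1] by simp
  with greater show ?thesis by (simp add: spow_def)
qed (simp add: spow_def)

lemma abs_spow: "\<bar>spow p a\<bar> = \<bar>a\<bar> powr (p - 1)"
proof (cases "a = 0")
  case False
  then show ?thesis
    using powr_add[of "\<bar>a\<bar>" "p - 2" 1] by (simp add: spow_def abs_mult)
qed (simp add: spow_def)

lemma spow_mult: "spow p (a * b) = spow p a * spow p b"
  by (simp add: spow_def abs_mult powr_mult)

lemma spow_sgn: "0 \<le> a \<Longrightarrow> 0 \<le> spow p a" "a \<le> 0 \<Longrightarrow> spow p a \<le> 0"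
  by (simp_all add: spow_def mult_nonneg_nonpos)

lemma mono_spow: "p > 1 \<Longrightarrow> mono (spow p)"
  by (intro monoI) (auto simp: spow_eq_powr intro!: diff_mono powr_mono2)

lemma continuous_on_spow: "p > 1 \<Longrightarrow> continuous_on A (spow p)"
  by (subst continuous_on_cong[OF refl spow_eq_powr])
     (auto intro!: continuous_intros continuous_on_powr')

text \<open>Stands in for Young's inequality: with \<open>m\<close> the larger of the two absolute
  values, the product is at most \<open>m powr (p - 1) * m = m powr p\<close>.\<close>

lemma abs_spow_mult_le:
  assumes "p > 1"
  shows "\<bar>spow p a * b\<bar> \<le> \<bar>a\<bar> powr p + \<bar>b\<bar> powr p"
proof -
  define m where "m = max \<bar>a\<bar> \<bar>b\<bar>"
  have m: "m \<ge> 0" "m powr p \<le> \<bar>a\<bar> powr p + \<bar>b\<bar> powr p"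
    by (auto simp: m_def max_def)
  have "\<bar>spow p a * b\<bar> \<le> m powr (p - 1) * m"
    unfolding abs_mult abs_spow using assms
    by (intro mult_mono powr_mono2) (auto simp: m_def)
  also have "\<dots> = m powr p"
    using powr_mult_base[of m "p - 1"] m(1) by (simp add: mult.commute)
  finally show ?thesis using m(2) by linarith
qed

text \<open>
  The convexity of \<open>\<Psi>\<close> bounds \<open>\<Psi> a - \<Psi> b\<close> above by \<open>\<Psi>' a (a - b)\<close> and below by \<open>\<Psi>' b (a - b)\<close>.
\<close>

lemma spow_convex_ineq:
  fixes \<Psi> \<Psi>' :: "real \<Rightarrow> real"
  assumes p: "p > 1" and tangent: "\<And>x c. \<Psi>' c * (x - c) \<le> \<Psi> x - \<Psi> c"
    and A: "0 \<le> A" and B: "0 \<le> B"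
  shows "spow p (\<Psi> a - \<Psi> b) * (A - B) \<le> spow p (a - b) * (A * spow p (\<Psi>' a) - B * spow p (\<Psi>' b))"
proof -
  have "\<Psi> a - \<Psi> b \<le> \<Psi>' a * (a - b)"
    using tangent[of a b] by (simp add: algebra_simps)
  then have "spow p (\<Psi> a - \<Psi> b) \<le> spow p (\<Psi>' a) * spow p (a - b)"
    using monoD[OF mono_spow[OF p]] by (metis spow_mult)
  moreover have "spow p (\<Psi>' b) * spow p (a - b) \<le> spow p (\<Psi> a - \<Psi> b)"
    using monoD[OF mono_spow[OF p] tangent[of b a]] by (simp add: spow_mult)
  \<comment> \<open>The upper bound is multiplied by \<open>A\<close>, the lower one by
    \<open>B\<close>, both nonnegative, and the results are subtracted.\<close>
  ultimately show ?thesis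
    using mult_left_mono[OF _ A] mult_left_mono[OF _ B]
    by (smt (verit, best) mult.commute mult.left_commute right_diff_distrib)
qed

section \<open>Lipschitz approximation from below by inf-convolution\<close>

text \<open>The Pasch-Hausdorff envelope: for \<open>h\<close> bounded below, the largest minorant
  of \<open>h\<close> with Lipschitz constant \<open>n\<close>.\<close>

definition inf_conv :: "(real \<Rightarrow> real) \<Rightarrow> nat \<Rightarrow> real \<Rightarrow> real" where
  "inf_conv h n t = (INF r. h r + real n * \<bar>t - r\<bar>)"

context
  fixes h :: "real \<Rightarrow> real" and C :: real
  assumes h_nonneg: "\<And>t. 0 \<le> h t" and h_le: "\<And>t. h t \<le> C"
begin

lemma inf_conv_bdd_below: "bdd_below (range (\<lambda>r. h r + real n * \<bar>t - r\<bar>))"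
  by (rule bdd_belowI[of _ 0]) (auto simp: h_nonneg)

lemma inf_conv_le: "inf_conv h n t \<le> h r + real n * \<bar>t - r\<bar>"
  unfolding inf_conv_def by (rule cINF_lower[OF inf_conv_bdd_below]) simp

lemma inf_conv_greatest: "(\<And>r. a \<le> h r + real n * \<bar>t - r\<bar>) \<Longrightarrow> a \<le> inf_conv h n t"
  unfolding inf_conv_def by (rule cINF_greatest) auto

lemma inf_conv_nonneg: "0 \<le> inf_conv h n t"
  by (rule inf_conv_greatest) (simp add: h_nonneg)

lemma inf_conv_le_self: "inf_conv h n t \<le> h t"
  using inf_conv_le[of n t t] by simp

text \<open>By the triangle inequality, a competitor \<open>r\<close> for \<open>y\<close> also
  serves \<open>x\<close>, at an extra cost of at most
  \<open>real n * \<bar>x - y\<bar>\<close>.\<close>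

lemma inf_conv_lipschitz: "\<bar>inf_conv h n t - inf_conv h n t'\<bar> \<le> real n * \<bar>t - t'\<bar>"
proof -
  have *: "inf_conv h n x - real n * \<bar>x - y\<bar> \<le> inf_conv h n y" for x y
  proof (rule inf_conv_greatest)
    fix r
    have "real n * \<bar>x - r\<bar> \<le> real n * (\<bar>x - y\<bar> + \<bar>y - r\<bar>)"
      by (rule mult_left_mono) auto
    then show "inf_conv h n x - real n * \<bar>x - y\<bar> \<le> h r + real n * \<bar>y - r\<bar>"
      using inf_conv_le[of n x r] by (simp add: distrib_left)
  qed
  show ?thesis
    using *[of t t'] *[of t' t] by (simp add: abs_minus_commute abs_le_iff)
qed

text \<open>Shifting a competitor \<open>r\<close> for \<open>y\<close> left by \<open>y - x\<close>
  gives one for \<open>x\<close> with the same distance penalty and no larger value of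
  \<open>h\<close>.\<close>

lemma mono_inf_conv:
  assumes "mono h"
  shows "mono (inf_conv h n)"
proof (rule monoI)
  fix x y :: real assume "x \<le> y"
  show "inf_conv h n x \<le> inf_conv h n y"
  proof (rule inf_conv_greatest)
    fix r
    have "inf_conv h n x \<le> h (r - (y - x)) + real n * \<bar>x - (r - (y - x))\<bar>"
      by (rule inf_conv_le)
    also have "\<dots> = h (r - (y - x)) + real n * \<bar>y - r\<bar>"
      by (simp add: algebra_simps)
    also have "\<dots> \<le> h r + real n * \<bar>y - r\<bar>"
      using monoD[OF assms, of "r - (y - x)" r] \<open>x \<le> y\<close> by simp
    finally show "inf_conv h n x \<le> h r + real n * \<bar>y - r\<bar>" .
  qed
qed

text \<open>Competitors within \<open>d\<close> of \<open>t\<close> have values close to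
  \<open>h t\<close> by continuity. All others pay a penalty of at least \<open>n * d\<close>, which
  for large \<open>n\<close> exceeds \<open>C\<close> and hence \<open>h t\<close>.\<close>

lemma inf_conv_tendsto:
  assumes cont: "isCont h t"
  shows "(\<lambda>n. inf_conv h n t) \<longlonglongrightarrow> h t"
proof (rule LIMSEQ_I)
  fix e :: real assume e: "0 < e"
  then obtain d where d: "d > 0" and hd: "\<And>r. \<bar>r - t\<bar> < d \<Longrightarrow> \<bar>h r - h t\<bar> < e / 2"
    using cont[unfolded continuous_at_eps_delta, rule_format, of "e / 2"] by (auto simp: dist_real_def)
  obtain N :: nat where N: "C / d < real N"
    using reals_Archimedean2 by blast
  have "norm (inf_conv h n t - h t) < e" if n: "n \<ge> N" for n
  proof -
    have "h t - e / 2 \<le> inf_conv h n t"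
    proof (rule inf_conv_greatest)
      fix r
      show "h t - e / 2 \<le> h r + real n * \<bar>t - r\<bar>"
      proof (cases "\<bar>r - t\<bar> < d")
        case True
        have "0 \<le> real n * \<bar>t - r\<bar>" by simp
        with hd[OF True] show ?thesis by linarith
      next
        case False
        have "C < real N * d" using N d by (simp add: divide_less_eq)
        also have "\<dots> \<le> real n * \<bar>t - r\<bar>"
          using n False d by (intro mult_mono) auto
        finally show ?thesis using h_le[of t] h_nonneg[of r] e by linarith
      qed
    qed
    with inf_conv_le_self[of n t] e show ?thesis by simp
  qed
  then show "\<exists>N. \<forall>n\<ge>N. norm (inf_conv h n t - h t) < e" by blast
qed

end

section \<open>Passage to the limit, and measurability on the product space\<close>

text \<open>
  Fatou's lemma with an integrable minorant, obtained by dominated convergence for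
  \<open>min (F n) f\<close>.
\<close>

lemma integral_le_lim:
  fixes F :: "nat \<Rightarrow> 'a \<Rightarrow> real"
  assumes F: "\<And>n. integrable M (F n)" and G: "integrable M G" and f: "integrable M f"
    and lower: "\<And>n. AE x in M. - G x \<le> F n x"
    and lim: "AE x in M. \<exists>l. (\<lambda>n. F n x) \<longlonglongrightarrow> l \<and> f x \<le> l"
    and B: "(\<lambda>n. integral\<^sup>L M (F n)) \<longlonglongrightarrow> B"
  shows "integral\<^sup>L M f \<le> B"
proof -
  have "(\<lambda>n. \<integral>x. min (F n x) (f x) \<partial>M) \<longlonglongrightarrow> integral\<^sup>L M f"
  proof (rule integral_dominated_convergence[where w = "\<lambda>x. \<bar>G x\<bar> + \<bar>f x\<bar>"])
    show "AE x in M. (\<lambda>n. min (F n x) (f x)) \<longlonglongrightarrow> f x"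
      using lim
    proof eventually_elim
      case (elim x)
      then obtain l where l: "(\<lambda>n. F n x) \<longlonglongrightarrow> l" "f x \<le> l" by blast
      show ?case
        using tendsto_min[OF l(1) tendsto_const[of "f x"]] l(2) by (simp add: min_absorb2)
    qed
    show "AE x in M. norm (min (F n x) (f x)) \<le> \<bar>G x\<bar> + \<bar>f x\<bar>" for n
      using lower[of n] by eventually_elim auto
  qed (use F G f in auto)
  moreover have "(\<integral>x. min (F n x) (f x) \<partial>M) \<le> integral\<^sup>L M (F n)" for n
    using F f by (intro integral_mono) auto
  ultimately show ?thesis
    using B by (blast intro: LIMSEQ_le)
qed

text \<open>A null set times the whole space is null. The argument runs through
  \<open>lborel\<close>, which on the product is the product measure; \<open>lebesgue\<close> there
  is its completion.\<close>

lemma AE_lebesgue_fst_snd: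
  fixes P :: "'a::euclidean_space \<Rightarrow> bool"
  assumes "AE x in lebesgue. P x"
  shows "AE z in (lebesgue :: ('a \<times> 'a) measure). P (fst z) \<and> P (snd z)"
proof -
  from assms have "AE x in lborel. P x"
    by (simp add: AE_completion_iff)
  then obtain N where N: "N \<in> null_sets lborel" "{x. \<not> P x} \<subseteq> N"
    by (auto simp: eventually_ae_filter)
  have "N \<times> UNIV \<in> null_sets (lborel \<Otimes>\<^sub>M lborel :: ('a \<times> 'a) measure)"
    "UNIV \<times> N \<in> null_sets (lborel \<Otimes>\<^sub>M lborel :: ('a \<times> 'a) measure)"
    using N(1) by (auto simp: null_sets_def lborel.emeasure_pair_measure_Times)
  then have "N \<times> UNIV \<union> UNIV \<times> N \<in> null_sets (lborel :: ('a \<times> 'a) measure)"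
    by (simp add: lborel_prod null_sets.Un)
  moreover have "{z. \<not> (P (fst z) \<and> P (snd z))} \<subseteq> N \<times> UNIV \<union> UNIV \<times> N"
    using N(2) by auto
  ultimately have "AE z in (lborel :: ('a \<times> 'a) measure). P (fst z) \<and> P (snd z)"
    by (intro AE_I'[where N = "N \<times> UNIV \<union> UNIV \<times> N"]) auto
  then show ?thesis by (simp add: AE_completion_iff)
qed

text \<open>A Borel function equal to \<open>u\<close> almost everywhere composes measurably with
  the projections. Replacing it by \<open>u\<close> changes values only on a null set of the
  complete product measure.\<close>

lemma borel_measurable_lebesgue_fst_snd:
  fixes u :: "'a::euclidean_space \<Rightarrow> real"
  assumes "u \<in> borel_measurable lebesgue"
  shows "(\<lambda>z. u (fst z)) \<in> borel_measurable (lebesgue :: ('a \<times> 'a) measure)"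
    "(\<lambda>z. u (snd z)) \<in> borel_measurable (lebesgue :: ('a \<times> 'a) measure)"
proof -
  obtain u' where u': "u' \<in> borel_measurable lborel" "AE x in lborel. u x = u' x"
    using completion_ex_borel_measurable_real[OF assms] by blast
  have "AE x in lebesgue. u x = u' x"
    using u'(2) by (simp add: AE_completion_iff)
  then have ae: "AE z in (lebesgue :: ('a \<times> 'a) measure). u (fst z) = u' (fst z) \<and> u (snd z) = u' (snd z)"
    by (rule AE_lebesgue_fst_snd)
  have "(\<lambda>z. u' (fst z)) \<in> borel_measurable (lborel :: ('a \<times> 'a) measure)"
    "(\<lambda>z. u' (snd z)) \<in> borel_measurable (lborel :: ('a \<times> 'a) measure)"
    using u'(1) unfolding lborel_prod[symmetric] by measurable
  then have "(\<lambda>z. u' (fst z)) \<in> borel_measurable (lebesgue :: ('a \<times> 'a) measure)"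
    "(\<lambda>z. u' (snd z)) \<in> borel_measurable (lebesgue :: ('a \<times> 'a) measure)"
    by (auto intro: measurable_completion)
  note * = this[THEN borel_measurable_AE]
  show "(\<lambda>z. u (fst z)) \<in> borel_measurable (lebesgue :: ('a \<times> 'a) measure)"
    by (rule *(1)) (use ae in \<open>auto elim: eventually_mono\<close>)
  show "(\<lambda>z. u (snd z)) \<in> borel_measurable (lebesgue :: ('a \<times> 'a) measure)"
    by (rule *(2)) (use ae in \<open>auto elim: eventually_mono\<close>)
qed

section \<open>Energy estimates and admissible test functions\<close>

lemma Wsp0D:
  assumes "u \<in> Wsp0 s p \<Omega>"
  shows "u \<in> borel_measurable lebesgue" "integrable lebesgue (\<lambda>x. \<bar>u x\<bar> powr p)"
    "gagliardo_energy s p u < \<infinity>" "AE x in lebesgue. x \<notin> \<Omega> \<longrightarrow> u x = 0"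
  using assms by (auto simp: Wsp0_def Wsp_def)

context
  fixes s p :: real
  assumes p: "p > 1"
begin

abbreviation kernel :: "(real ^ 'n) \<times> (real ^ 'n) \<Rightarrow> real" where
  "kernel z \<equiv> norm (fst z - snd z) powr (real CARD('n) + s * p)"

lemma borel_measurable_kernel: "kernel \<in> borel_measurable lebesgue"
proof -
  have "(\<lambda>z. fst z - snd z) \<in> borel_measurable (borel :: ((real ^ 'n) \<times> (real ^ 'n)) measure)"
    by (intro borel_measurable_continuous_onI continuous_intros)
  then have "kernel \<in> borel_measurable (lborel :: ((real ^ 'n) \<times> (real ^ 'n)) measure)"
    by measurable
  then show ?thesis by (rule measurable_completion)
qed

lemma integrable_energy_density:
  fixes w :: "real ^ 'n \<Rightarrow> real"
  assumes "w \<in> borel_measurable lebesgue" "gagliardo_energy s p w < \<infinity>"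
  shows "integrable lebesgue (\<lambda>z. \<bar>w (fst z) - w (snd z)\<bar> powr p / kernel z)"
proof (rule integrableI_bounded)
  note [measurable] = borel_measurable_lebesgue_fst_snd[OF assms(1)] borel_measurable_kernel
  show "(\<lambda>z. \<bar>w (fst z) - w (snd z)\<bar> powr p / kernel z) \<in> borel_measurable lebesgue"
    by measurable
  show "(\<integral>\<^sup>+ z. ennreal (norm (\<bar>w (fst z) - w (snd z)\<bar> powr p / kernel z)) \<partial>lebesgue) < \<infinity>"
    using assms(2) by (simp add: gagliardo_energy_def)
qed

text \<open>The pointwise bound \<open>abs_spow_mult_le\<close> dominates the integrand by the sum
  of the two energy densities.\<close>

lemma integrable_form:
  fixes w v :: "real ^ 'n \<Rightarrow> real"
  assumes w: "w \<in> borel_measurable lebesgue" "gagliardo_energy s p w < \<infinity>"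
    and v: "v \<in> borel_measurable lebesgue" "gagliardo_energy s p v < \<infinity>"
  shows "integrable lebesgue
           (\<lambda>z. spow p (w (fst z) - w (snd z)) * (v (fst z) - v (snd z)) / kernel z)"
proof (rule Bochner_Integration.integrable_bound)
  note [measurable] = borel_measurable_lebesgue_fst_snd[OF w(1)]
    borel_measurable_lebesgue_fst_snd[OF v(1)] borel_measurable_kernel
  show "(\<lambda>z. spow p (w (fst z) - w (snd z)) * (v (fst z) - v (snd z)) / kernel z)
          \<in> borel_measurable lebesgue"
    unfolding spow_def by measurable
  show "integrable lebesgue (\<lambda>z. \<bar>w (fst z) - w (snd z)\<bar> powr p / kernel z
          + \<bar>v (fst z) - v (snd z)\<bar> powr p / kernel z)"
    using integrable_energy_density[OF w] integrable_energy_density[OF v] by simp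
  show "AE z in lebesgue. norm (spow p (w (fst z) - w (snd z)) * (v (fst z) - v (snd z)) / kernel z)
          \<le> norm (\<bar>w (fst z) - w (snd z)\<bar> powr p / kernel z
              + \<bar>v (fst z) - v (snd z)\<bar> powr p / kernel z)"
    using abs_spow_mult_le[OF p]
    by (intro AE_I2) (simp add: divide_right_mono flip: add_divide_distrib)
qed

text \<open>Covers both compositions such as \<open>\<Psi> (u x)\<close>, with \<open>b = 0\<close>,
  and products such as \<open>\<psi> x * k (u x)\<close>.\<close>

lemma gagliardo_energy_finite:
  fixes w u v :: "real ^ 'n \<Rightarrow> real"
  assumes u: "u \<in> borel_measurable lebesgue" "gagliardo_energy s p u < \<infinity>"
    and v: "v \<in> borel_measurable lebesgue" "gagliardo_energy s p v < \<infinity>"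
    and a: "0 \<le> a" and b: "0 \<le> b"
    and le: "AE z in lebesgue. \<bar>w (fst z) - w (snd z)\<bar>
               \<le> a * \<bar>u (fst z) - u (snd z)\<bar> + b * \<bar>v (fst z) - v (snd z)\<bar>"
  shows "gagliardo_energy s p w < \<infinity>"
proof -
  define R where "R z = (2 * a) powr p * (\<bar>u (fst z) - u (snd z)\<bar> powr p / kernel z)
    + (2 * b) powr p * (\<bar>v (fst z) - v (snd z)\<bar> powr p / kernel z)" for z
  have "integrable lebesgue R"
    unfolding R_def
    by (intro Bochner_Integration.integrable_add integrable_mult_right
        integrable_energy_density u v)
  then have "(\<integral>\<^sup>+ z. ennreal (norm (R z)) \<partial>lebesgue) < \<infinity>"
    by (simp add: integrable_iff_bounded)
  moreover have "gagliardo_energy s p w \<le> (\<integral>\<^sup>+ z. ennreal (norm (R z)) \<partial>lebesgue)"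
    unfolding gagliardo_energy_def
  proof (rule nn_integral_mono_AE)
    show "AE z in lebesgue. ennreal (\<bar>w (fst z) - w (snd z)\<bar> powr p / kernel z) \<le> ennreal (norm (R z))"
      using le
    proof eventually_elim
      case (elim z)
      define x where "x = a * \<bar>u (fst z) - u (snd z)\<bar>"
      define y where "y = b * \<bar>v (fst z) - v (snd z)\<bar>"
      have xy: "0 \<le> x" "0 \<le> y" using a b by (simp_all add: x_def y_def)
      \<comment> \<open>A sum is at most twice its larger term, and the maximum is one of
        \<open>x\<close> and \<open>y\<close>; this gives the factors \<open>2 * a\<close> and
        \<open>2 * b\<close> in \<open>R\<close>.\<close>
      have "\<bar>w (fst z) - w (snd z)\<bar> powr p \<le> (2 * max x y) powr p"
        using elim p by (intro powr_mono2) (auto simp: x_def y_def)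
      also have "\<dots> \<le> (2 * x) powr p + (2 * y) powr p"
        by (auto simp: max_def)
      also have "\<dots> / kernel z = R z"
        using a b by (simp add: R_def x_def y_def powr_mult add_divide_distrib)
      finally show ?case
        by (intro ennreal_leI) (auto simp: divide_right_mono intro: order_trans)
    qed
  qed
  ultimately show ?thesis by (rule le_less_trans[rotated])
qed

text \<open>A discrete product rule bounds the increments: the bound on \<open>\<psi>\<close>
  controls the increment of \<open>k (u x)\<close>, and the bound on \<open>k\<close> that of
  \<open>\<psi>\<close>.\<close>

lemma Wsp0_mult_lipschitz:
  fixes \<Omega> :: "(real ^ 'n) set"
  assumes \<psi>: "\<psi> \<in> Wsp0 s p \<Omega>" and M: "AE x in lebesgue. \<bar>\<psi> x\<bar> \<le> M"
    and u: "u \<in> Wsp0 s p \<Omega>"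
    and k: "\<And>t. \<bar>k t\<bar> \<le> C" and lip: "\<And>a b. \<bar>k a - k b\<bar> \<le> L * \<bar>a - b\<bar>" and L: "0 \<le> L"
    and meas: "k \<in> borel_measurable borel"
  shows "(\<lambda>x. \<psi> x * k (u x)) \<in> Wsp0 s p \<Omega>"
proof -
  note D = Wsp0D[OF \<psi>] Wsp0D[OF u]
  have C: "0 \<le> C" using k[of 0] by linarith
  have [measurable]: "u \<in> borel_measurable lebesgue" "\<psi> \<in> borel_measurable lebesgue"
    "k \<in> borel_measurable borel"
    using D meas by auto
  have m: "(\<lambda>x. \<psi> x * k (u x)) \<in> borel_measurable lebesgue"
    by measurable
  have "integrable lebesgue (\<lambda>x. \<bar>\<psi> x * k (u x)\<bar> powr p)"
  proof (rule Bochner_Integration.integrable_bound)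
    show "integrable lebesgue (\<lambda>x. \<bar>\<psi> x\<bar> powr p * C powr p)" using D by simp
    show "AE x in lebesgue. norm (\<bar>\<psi> x * k (u x)\<bar> powr p) \<le> norm (\<bar>\<psi> x\<bar> powr p * C powr p)"
      using k C p by (intro AE_I2) (auto simp: abs_mult powr_mult intro!: mult_left_mono powr_mono2)
  qed measurable
  moreover have "gagliardo_energy s p (\<lambda>x. \<psi> x * k (u x)) < \<infinity>"
  proof (rule gagliardo_energy_finite[of u \<psi> "\<bar>M\<bar> * L" C])
    show "AE z in lebesgue. \<bar>\<psi> (fst z) * k (u (fst z)) - \<psi> (snd z) * k (u (snd z))\<bar>
        \<le> \<bar>M\<bar> * L * \<bar>u (fst z) - u (snd z)\<bar> + C * \<bar>\<psi> (fst z) - \<psi> (snd z)\<bar>"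
      using AE_lebesgue_fst_snd[OF M]
    proof eventually_elim
      case (elim z)
      have "\<psi> (fst z) * k (u (fst z)) - \<psi> (snd z) * k (u (snd z))
        = \<psi> (snd z) * (k (u (fst z)) - k (u (snd z))) + k (u (fst z)) * (\<psi> (fst z) - \<psi> (snd z))"
        by (simp add: algebra_simps)
      also have "\<bar>\<dots>\<bar> \<le> \<bar>\<psi> (snd z)\<bar> * \<bar>k (u (fst z)) - k (u (snd z))\<bar>
          + \<bar>k (u (fst z))\<bar> * \<bar>\<psi> (fst z) - \<psi> (snd z)\<bar>"
        by (simp add: abs_triangle_ineq flip: abs_mult)
      also have "\<dots> \<le> \<bar>M\<bar> * (L * \<bar>u (fst z) - u (snd z)\<bar>) + C * \<bar>\<psi> (fst z) - \<psi> (snd z)\<bar>"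
        using elim lip k C by (intro add_mono mult_mono) auto
      finally show ?case by (simp add: mult.assoc)
    qed
  qed (use D C L in auto)
  moreover have "AE x in lebesgue. x \<notin> \<Omega> \<longrightarrow> \<psi> x * k (u x) = 0"
    using D by (auto elim: eventually_mono)
  ultimately show ?thesis
    using m by (simp add: Wsp0_def Wsp_def)
qed

end

section \<open>The inequality for the convex composition\<close>

theorem proposition1p7:
  fixes \<Omega> :: "(real ^ 'n) set"
    and g u :: "real ^ 'n \<Rightarrow> real"
    and \<Psi> :: "real \<Rightarrow> real"
    and s p :: real
  assumes "p > 1" and "0 < s" and "s < 1"
    and "bounded_C11_domain \<Omega>"
    and "in_Wsp0_dual s p \<Omega> g" and "integrable (lebesgue_on \<Omega>) g"
    and "weak_solution s p \<Omega> g u"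
    and "C2_real \<Psi>" and "convex_on UNIV \<Psi>" and "\<exists>L. L-lipschitz_on UNIV \<Psi>" and "\<Psi> 0 = 0"
    and "deriv (deriv \<Psi>) \<in> L_infinity UNIV \<or> constant_sign \<Omega> g"
  shows "\<forall>\<psi>. \<psi> \<in> Wsp0 s p \<Omega> \<and> \<psi> \<in> L_infinity \<Omega> \<and> (AE x in lebesgue. 0 \<le> \<psi> x) \<longrightarrow>
           frac_plap s p (\<lambda>x. \<Psi> (u x)) \<psi>
             \<le> (\<integral>x. spow p (deriv \<Psi> (u x)) * g x * \<psi> x \<partial>lebesgue_on \<Omega>)"
proof (intro allI impI, elim conjE)
  fix \<psi> :: "real ^ 'n \<Rightarrow> real"
  assume \<psi>: "\<psi> \<in> Wsp0 s p \<Omega>" and \<psi>_Linf: "\<psi> \<in> L_infinity \<Omega>"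
    and \<psi>_nonneg: "AE x in lebesgue. 0 \<le> \<psi> x"
  note p = \<open>p > 1\<close>
  have \<Omega>: "\<Omega> \<in> sets lebesgue"
    using assms(4) by (auto simp: bounded_C11_domain_def)
  have u: "u \<in> Wsp0 s p \<Omega>" using assms(7) by (simp add: weak_solution_def)
  have weak: "frac_plap s p u v = (\<integral>x. g x * v x \<partial>lebesgue_on \<Omega>)"
    if "v \<in> Wsp0 s p \<Omega>" "AE x in lebesgue. 0 \<le> v x" for v
    using assms(7) that by (simp add: weak_solution_def)
  note D = Wsp0D[OF \<psi>] Wsp0D[OF u]

  obtain M0 where "AE x in lebesgue_on \<Omega>. \<bar>\<psi> x\<bar> \<le> M0"
    using \<psi>_Linf by (auto simp: L_infinity_def)
  then have "AE x in lebesgue. x \<in> \<Omega> \<longrightarrow> \<bar>\<psi> x\<bar> \<le> M0"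
    using \<Omega> by (simp add: AE_restrict_space_iff)
  moreover have "AE x in lebesgue. x \<notin> \<Omega> \<longrightarrow> \<psi> x = 0" using D by simp
  \<comment> \<open>Since \<open>\<psi>\<close> vanishes outside \<open>\<Omega>\<close>, its bound
    extends to the whole space; the absolute value makes the bound nonnegative there.\<close>
  ultimately have M: "AE x in lebesgue. \<bar>\<psi> x\<bar> \<le> \<bar>M0\<bar>"
    by eventually_elim auto

  obtain L where L: "L-lipschitz_on UNIV \<Psi>" using assms(10) by blast
  have L0: "0 \<le> L" using L by (rule lipschitz_on_nonneg)
  have \<Psi>_lip: "\<bar>\<Psi> a - \<Psi> b\<bar> \<le> L * \<bar>a - b\<bar>" for a b
    using lipschitz_onD[OF L, of a b] by (simp add: dist_real_def)
  have tangent: "deriv \<Psi> c * (x - c) \<le> \<Psi> x - \<Psi> c" for x c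
    using assms(8,9) by (intro convex_on_imp_above_tangent[of UNIV])
      (auto simp: C2_real_def differentiable_on_def DERIV_deriv_iff_real_differentiable)
  have mono: "mono (deriv \<Psi>)"
  proof (rule monoI)
    fix a b :: real assume "a \<le> b"
    have "deriv \<Psi> a * (b - a) \<le> deriv \<Psi> b * (b - a)"
      using tangent[of a b] tangent[of b a] by (simp add: algebra_simps)
    then show "deriv \<Psi> a \<le> deriv \<Psi> b"
      using \<open>a \<le> b\<close> by (cases "a = b") auto
  qed
  have cont: "continuous_on UNIV (deriv \<Psi>)"
    using assms(8) by (auto simp: C2_real_def intro: differentiable_imp_continuous_on)
  \<comment> \<open>The tangent at \<open>c\<close>, compared with \<open>\<Psi>\<close> at distance
    one on either side, has slope between \<open>- L\<close> and \<open>L\<close>.\<close>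
  have bound: "\<bar>deriv \<Psi> c\<bar> \<le> L" for c
    using tangent[of c "c + 1"] tangent[of c "c - 1"] \<Psi>_lip[of "c + 1" c] \<Psi>_lip[of "c - 1" c] by auto

  \<comment> \<open>\<open>C\<close> bounds \<open>\<bar>spow p (deriv \<Psi> t)\<bar>\<close>, so
    the shifted function \<open>h\<close> takes values between 0 and \<open>2 * C\<close>.
    Nonnegativity matters because the weak equation admits only nonnegative test functions.\<close>
  define C where "C = L powr (p - 1)"
  define h where "h t = spow p (deriv \<Psi> t) + C" for t
  have "\<bar>spow p (deriv \<Psi> t)\<bar> \<le> C" for t
    unfolding abs_spow C_def using bound p by (intro powr_mono2) auto
  then have h: "0 \<le> h t" "h t \<le> 2 * C" for t
    unfolding h_def abs_le_iff by (smt (verit))+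
  have C: "0 \<le> C" by (simp add: C_def)
  have mono_h: "mono h"
    using monoD[OF mono_spow[OF p]] monoD[OF mono] by (auto simp: h_def intro!: monoI)
  have cont_h: "continuous_on UNIV h"
    unfolding h_def
    by (intro continuous_intros continuous_on_compose2[OF continuous_on_spow[OF p] cont]) auto

  define k where "k = inf_conv h"
  have k: "0 \<le> k n t" "k n t \<le> 2 * C" for n t
    using inf_conv_nonneg[of h "2 * C", OF h] inf_conv_le_self[of h "2 * C", OF h, of n t] h(2)[of t] by (auto simp: k_def intro: order_trans)
  have k_lip: "\<bar>k n a - k n b\<bar> \<le> real n * \<bar>a - b\<bar>" for n a b
    unfolding k_def by (rule inf_conv_lipschitz[of h "2 * C", OF h])
  have k_mono: "mono (k n)" for n
    unfolding k_def by (rule mono_inf_conv[of h "2 * C", OF h mono_h])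
  have k_lim: "(\<lambda>n. k n t) \<longlonglongrightarrow> h t" for t
    unfolding k_def using cont_h by (intro inf_conv_tendsto[of h "2 * C", OF h]) (simp add: continuous_on_eq_continuous_at)
  have [measurable]: "k n \<in> borel_measurable borel" for n
    by (rule borel_measurable_mono[OF k_mono])
  have [measurable]: "h \<in> borel_measurable borel"
    by (rule borel_measurable_mono[OF mono_h])
  have test: "(\<lambda>x. \<psi> x * k n (u x)) \<in> Wsp0 s p \<Omega>" for n
    by (rule Wsp0_mult_lipschitz[OF p \<psi> M u _ k_lip, of _ "2 * C"]) (use k in \<open>auto simp: abs_le_iff intro: order_trans[OF _ k(1)]\<close>)

  have meas_\<Psi>u: "(\<lambda>x. \<Psi> (u x)) \<in> borel_measurable lebesgue"
    by (rule borel_measurable_continuous_on[OF lipschitz_on_continuous_on[OF L] D(5)])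
  have energy_\<Psi>u: "gagliardo_energy s p (\<lambda>x. \<Psi> (u x)) < \<infinity>"
    using \<Psi>_lip L0 by (intro gagliardo_energy_finite[OF p D(5,7) D(5,7), of L 0]) auto

  \<comment> \<open>\<open>F n\<close>, \<open>E\<close> and \<open>H\<close> are the integrands of
    the form for \<open>u\<close> tested with \<psi> k_n(u), for \<open>u\<close> tested with
    \<psi>, and for \<Psi>(u) tested with \<psi>.\<close>
  define F where "F n z = spow p (u (fst z) - u (snd z))
    * (\<psi> (fst z) * k n (u (fst z)) - \<psi> (snd z) * k n (u (snd z))) / kernel s p z" for n z
  define E where "E z = spow p (u (fst z) - u (snd z)) * (\<psi> (fst z) - \<psi> (snd z)) / kernel s p z" for z
  define H where "H z = spow p (\<Psi> (u (fst z)) - \<Psi> (u (snd z))) * (\<psi> (fst z) - \<psi> (snd z)) / kernel s p z"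
    for z
  have F_int: "integrable lebesgue (F n)" for n
    unfolding F_def by (rule integrable_form[OF p D(5,7) Wsp0D(1,3)[OF test]])
  have E_int: "integrable lebesgue E"
    unfolding E_def by (rule integrable_form[OF p D(5,7) D(1,3)])
  have H_int: "integrable lebesgue H"
    unfolding H_def by (rule integrable_form[OF p meas_\<Psi>u energy_\<Psi>u D(1,3)])

  have \<psi>_nonneg2: "AE z in lebesgue. 0 \<le> \<psi> (fst z) \<and> 0 \<le> \<psi> (snd z)"
    by (rule AE_lebesgue_fst_snd[OF \<psi>_nonneg])
  define B where "B = (\<integral>x. g x * (\<psi> x * h (u x)) \<partial>lebesgue_on \<Omega>)"

  have gm: "g \<in> borel_measurable (lebesgue_on \<Omega>)" using assms(6) by auto
  have um: "u \<in> borel_measurable (lebesgue_on \<Omega>)" "\<psi> \<in> borel_measurable (lebesgue_on \<Omega>)"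
    by (auto intro: measurable_restrict_space1 D(1,5))
  note [measurable] = gm um

  \<comment> \<open>The weak equation turns each energy integral into an integral against
    \<open>g\<close>. There a constant multiple of \<open>\<bar>g x\<bar>\<close> dominates for all
    \<open>n\<close>.\<close>
  have lim: "(\<lambda>n. integral\<^sup>L lebesgue (F n)) \<longlonglongrightarrow> B"
  proof -
    have "integral\<^sup>L lebesgue (F n) = (\<integral>x. g x * (\<psi> x * k n (u x)) \<partial>lebesgue_on \<Omega>)" for n
    proof -
      have "AE x in lebesgue. 0 \<le> \<psi> x * k n (u x)"
        using \<psi>_nonneg by eventually_elim (use k in auto)
      with weak[OF test] show ?thesis
        unfolding frac_plap_def F_def by simp
    qed
    moreover have "(\<lambda>n. \<integral>x. g x * (\<psi> x * k n (u x)) \<partial>lebesgue_on \<Omega>) \<longlonglongrightarrow> B"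
      unfolding B_def
    proof (rule integral_dominated_convergence[where w = "\<lambda>x. \<bar>g x\<bar> * (\<bar>M0\<bar> * (2 * C))"])
      show "AE x in lebesgue_on \<Omega>. (\<lambda>n. g x * (\<psi> x * k n (u x))) \<longlonglongrightarrow> g x * (\<psi> x * h (u x))"
        by (intro AE_I2 tendsto_intros k_lim)
      show "AE x in lebesgue_on \<Omega>. norm (g x * (\<psi> x * k n (u x))) \<le> \<bar>g x\<bar> * (\<bar>M0\<bar> * (2 * C))" for n
      proof -
        have "AE x in lebesgue_on \<Omega>. \<bar>\<psi> x\<bar> \<le> \<bar>M0\<bar>"
          using M \<Omega> by (auto simp: AE_restrict_space_iff elim: eventually_mono)
        then show ?thesis
          by eventually_elim (use k in \<open>auto simp: abs_mult intro!: mult_mono\<close>)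
      qed
      show "integrable (lebesgue_on \<Omega>) (\<lambda>x. \<bar>g x\<bar> * (\<bar>M0\<bar> * (2 * C)))"
        using assms(6) by simp
    qed measurable
    ultimately show ?thesis by simp
  qed

  \<comment> \<open>The term \<open>C * E z\<close> accounts for the shift by \<open>C\<close> in
    \<open>h\<close>; it cancels at the end.\<close>
  have "(\<integral>z. H z + C * E z \<partial>lebesgue) \<le> B"
  proof (rule integral_le_lim[OF F_int _ _ _ _ lim, where G = "\<lambda>z. 2 * C * \<bar>E z\<bar>"])
    show "integrable lebesgue (\<lambda>z. 2 * C * \<bar>E z\<bar>)" "integrable lebesgue (\<lambda>z. H z + C * E z)"
      using E_int H_int by auto
    show "AE z in lebesgue. - (2 * C * \<bar>E z\<bar>) \<le> F n z" for n
      using \<psi>_nonneg2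
    proof eventually_elim
      case (elim z)
      let ?a = "u (fst z)" and ?b = "u (snd z)"
      \<comment> \<open>The product rule isolates the increment of \<open>k n\<close>. As
        \<open>k n\<close> is nondecreasing, this increment has the sign of \<open>?a - ?b\<close>,
        so the second summand is nonnegative. The first is at least
        \<open>- (2 * C * \<bar>E z\<bar>)\<close>, a minorant independent of
        \<open>n\<close>.\<close>
      have "F n z = k n ?a * E z + \<psi> (snd z) * (spow p (?a - ?b) * (k n ?a - k n ?b)) / kernel s p z"
        unfolding F_def E_def by (simp add: diff_divide_distrib add_divide_distrib algebra_simps)
      moreover have "0 \<le> spow p (?a - ?b) * (k n ?a - k n ?b)"
        using monoD[OF k_mono[of n], of ?a ?b] monoD[OF k_mono[of n], of ?b ?a] spow_sgn[of "?a - ?b" p]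
        by (cases "?a \<le> ?b") (auto intro: mult_nonneg_nonneg mult_nonpos_nonpos)
      moreover have "- (2 * C * \<bar>E z\<bar>) \<le> k n ?a * E z"
        using mult_right_mono[OF k(2)[of n ?a], of "\<bar>E z\<bar>"] k(1)[of n ?a] abs_ge_minus_self[of "k n ?a * E z"]
        by (simp add: abs_mult)
      ultimately show ?case
        using elim by (smt (verit) divide_nonneg_nonneg mult_nonneg_nonneg powr_ge_zero)
    qed
    show "AE z in lebesgue. \<exists>l. (\<lambda>n. F n z) \<longlonglongrightarrow> l \<and> H z + C * E z \<le> l"
      using \<psi>_nonneg2
    proof eventually_elim
      case (elim z)
      let ?a = "u (fst z)" and ?b = "u (snd z)" and ?A = "\<psi> (fst z)" and ?B = "\<psi> (snd z)"
      let ?l = "spow p (?a - ?b) * (?A * h ?a - ?B * h ?b) / kernel s p z"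
      have "(\<lambda>n. F n z) \<longlonglongrightarrow> ?l"
        unfolding F_def divide_inverse by (intro tendsto_intros k_lim)
      moreover have "H z + C * E z \<le> ?l"
      proof -
        \<comment> \<open>This is \<open>spow_convex_ineq\<close> with the shift term added to both
          sides; on the right it turns the signed powers of the derivative into values of
          \<open>h\<close>.\<close>
        have "spow p (\<Psi> ?a - \<Psi> ?b) * (?A - ?B) + C * (spow p (?a - ?b) * (?A - ?B))
            \<le> spow p (?a - ?b) * (?A * h ?a - ?B * h ?b)"
          using spow_convex_ineq[OF p tangent, of ?A ?B ?a ?b] elim
          by (simp add: h_def algebra_simps)
        then show ?thesis
          unfolding H_def E_def by (simp add: divide_right_mono flip: add_divide_distrib)
      qed
      ultimately show ?case by blast
    qed
  qed
  then have "integral\<^sup>L lebesgue H + C * integral\<^sup>L lebesgue E \<le> B"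
    using H_int E_int by simp
  moreover have "integral\<^sup>L lebesgue E = (\<integral>x. g x * \<psi> x \<partial>lebesgue_on \<Omega>)"
    using weak[OF \<psi> \<psi>_nonneg] unfolding frac_plap_def E_def .
  \<comment> \<open>Splitting \<open>h\<close> exposes \<open>C\<close> times the integral of
    \<open>g x * \<psi> x\<close>. By the weak equation for \<psi> this equals \<open>C\<close>
    times the integral of \<open>E\<close>, so both shift terms drop out.\<close>
  moreover have "B = (\<integral>x. spow p (deriv \<Psi> (u x)) * g x * \<psi> x \<partial>lebesgue_on \<Omega>)
      + C * (\<integral>x. g x * \<psi> x \<partial>lebesgue_on \<Omega>)"
  proof -
    have i: "integrable (lebesgue_on \<Omega>) (\<lambda>x. g x * \<psi> x)"
      using assms(5) \<psi> by (simp add: in_Wsp0_dual_def)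
    have "integrable (lebesgue_on \<Omega>) (\<lambda>x. g x * (\<psi> x * h (u x)))"
    proof (rule Bochner_Integration.integrable_bound)
      show "integrable (lebesgue_on \<Omega>) (\<lambda>x. 2 * C * (g x * \<psi> x))" using i by simp
      show "AE x in lebesgue_on \<Omega>. norm (g x * (\<psi> x * h (u x))) \<le> norm (2 * C * (g x * \<psi> x))"
      proof (rule AE_I2)
        fix x
        show "norm (g x * (\<psi> x * h (u x))) \<le> norm (2 * C * (g x * \<psi> x))"
          using mult_right_mono[OF h(2)[of "u x"], of "\<bar>g x * \<psi> x\<bar>"] h(1)[of "u x"] C
          by (simp add: abs_mult mult_ac)
      qed
    qed measurable
    then have "B - C * (\<integral>x. g x * \<psi> x \<partial>lebesgue_on \<Omega>)
        = (\<integral>x. g x * (\<psi> x * h (u x)) - C * (g x * \<psi> x) \<partial>lebesgue_on \<Omega>)"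
      using i by (simp add: B_def)
    also have "\<dots> = (\<integral>x. spow p (deriv \<Psi> (u x)) * g x * \<psi> x \<partial>lebesgue_on \<Omega>)"
      by (intro Bochner_Integration.integral_cong) (auto simp: h_def algebra_simps)
    finally show ?thesis by simp
  qed
  ultimately show "frac_plap s p (\<lambda>x. \<Psi> (u x)) \<psi>
      \<le> (\<integral>x. spow p (deriv \<Psi> (u x)) * g x * \<psi> x \<partial>lebesgue_on \<Omega>)"
    unfolding frac_plap_def H_def by simp
qed

end
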